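(* Let $A_0,\dots,A_n\in\mathcal S^p$ be such that the system $\mathcal A(\mathbf x)\in\mathcal{COP}^p$ is consistent, and let $Y^*$ be a maximum slack in this system. The condition B1) for any $\mathbf z\in\mathbb R^{n+1}$, the equalities $\boldsymbol\tau(i)^\top\mathcal B(\mathbf z)\boldsymbol\tau(j)=0$ for all $(i,j)\in V_0$ imply the equalities $\mathbf e_k^\top\mathcal B(\mathbf z)\boldsymbol\tau(j)=0$ for all $k\in M(j)$ and all $j\in J$ is equivalent to the following condition: B2) the set $\mathcal R(\mathcal B)\cap\bigl(\mathrm{tan}(Y^*,\mathcal{COP}^p)\setminus\mathrm{ldir}(Y^*,\mathcal{COP}^p)\bigr)$ is empty.
   Context: Fix integers $p>1$, $n\ge 1$. $\mathcal S^p$ is the space of real symmetric $p\times p$ matrices; $\mathbf e_1,\dots,\mathbf e_p$ is the standard basis of $\mathbb R^p$; $\mathbb R^p_+$ is the set of vectors with non-negative components; $P=\{1,\dots,p\}$; $T=\{\mathbf t\in\mathbb R^p_+:\sum_{k\in P} t_k=1\}$; $\mathcal{COP}^p=\{D\in\mathcal S^p:\mathbf t^\top D\mathbf t\ge 0\ \forall \mathbf t\in\mathbb R^p_+\}$. Given $A_0,\dots,A_n\in\mathcal S^p$, put $\mathcal A(\mathbf x)=A_0+\sum_{m=1}^n x_mA_m$ for $\mathbf x\in\mathbb R^n$, $\mathcal B(\mathbf z)=\sum_{m=0}^n z_mA_m$ for $\mathbf z=(z_0,\dots,z_n)^\top\in\mathbb R^{n+1}$, $\mathcal R(\mathcal B)=\{\mathcal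 B(\mathbf z):\mathbf z\in\mathbb R^{n+1}\}$, and $X=\{\mathbf x\in\mathbb R^n:\mathcal A(\mathbf x)\in\mathcal{COP}^p\}$. The system is consistent if $X\ne\emptyset$. $T_{im}=\{\mathbf t\in T:\mathbf t^\top\mathcal A(\mathbf x)\mathbf t=0\ \forall\mathbf x\in X\}$ is the set of normalized immobile indices; it is empty or a finite union of convex bounded polyhedra. $\{\boldsymbol\tau(j):j\in J\}$, $|J|<\infty$, is the set of vertices of $\mathrm{conv}\,T_{im}$ ($J=\emptyset$ if $T_{im}=\emptyset$). For $j\in J$: $M(j)=\{k\in P:\mathbf e_k^\top\mathcal A(\mathbf x)\boldsymbol\tau(j)=0\ \forall\mathbf x\in X\}$. Subsets $J(s)\subset J$, $s\in S$ ($S$ finite; the subsets need not be disjoint) are fixed such that $T_{im}=\bigcup_{s\in S}T_{im}(s)$ with $T_{im}(s)=\mathrm{conv}\{\boldsymbol\tau(j):j\in J(s)\}$, and such that for every $s\in S$ the set $P_*(s)=\bigcup_{j\in J(s)}\{k\in P:\tau_k(j)>0\}$ satisfies $P_*(s)\subset M(j)$ for all $j\in J(s)$; it is known that such subsets exist. Numbering $J(s)=\{i_1,\dots,i_{k(s)}\}$, put $V(s)=\{(i_k,i_q):1\le k\le q\le k(s)\}$ and $V_0=\bigcup_{s\in S}V(s)$. A matrix $Y$ is a maximum slack in the system if $Y\in\mathrm{relint}\,\mathcal D$ (relative interior), where $\mathcal D=\{\mathcal A(\mathbf x):\mathbf x\in X\}$. For $Y\in\mathcal S^p$: $\mathrm{dir}(Y,\mathcal{COP}^p)=\{D\in\mathcal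 S^p:Y+\varepsilon D\in\mathcal{COP}^p\text{ for some }\varepsilon>0\}$, $\mathrm{ldir}(Y,\mathcal{COP}^p)=\mathrm{dir}(Y,\mathcal{COP}^p)\cap(-\mathrm{dir}(Y,\mathcal{COP}^p))$, and $\mathrm{tan}(Y,\mathcal{COP}^p)=\mathrm{cl}(\mathrm{dir}(Y,\mathcal{COP}^p))\cap(-\mathrm{cl}(\mathrm{dir}(Y,\mathcal{COP}^p)))$, where $\mathrm{cl}$ is the closure. *)

theory Defs
  imports "HOL-Analysis.Analysis"
begin

definition sym_mats :: "(real^'p^'p) set" where
  "sym_mats = {D. transpose D = D}"

definition COP :: "(real^'p::finite^'p) set" where
  "COP = {D \<in> sym_mats. \<forall>t::real^'p. (\<forall>k. 0 \<le> t $ k) \<longrightarrow> 0 \<le> t \<bullet> (D *v t)}"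

definition simplex_T :: "(real^'p::finite) set" where
  "simplex_T = {t. (\<forall>k. 0 \<le> t $ k) \<and> (\<Sum>k\<in>UNIV. t $ k) = 1}"

definition calA ::
  "real^'p^'p \<Rightarrow> ('n::finite \<Rightarrow> real^'p^'p) \<Rightarrow> real^'n \<Rightarrow> real^'p::finite^'p" where
  "calA A0 A x = A0 + (\<Sum>m\<in>UNIV. (x $ m) *\<^sub>R A m)"

(* With n = CARD('n), the vector (z_0, z_1, ..., z_n) of R^(n+1) is the pair of
   z_0 and (z_1, ..., z_n). *)
definition calB ::
  "real^'p^'p \<Rightarrow> ('n::finite \<Rightarrow> real^'p^'p) \<Rightarrow> real \<times> (real^'n) \<Rightarrow> real^'p::finite^'p" where
  "calB A0 A z = fst z *\<^sub>R A0 + (\<Sum>m\<in>UNIV. (snd z $ m) *\<^sub>R A m)"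

definition feasible ::
  "real^'p^'p \<Rightarrow> ('n::finite \<Rightarrow> real^'p::finite^'p) \<Rightarrow> (real^'n) set" where
  "feasible A0 A = {x. calA A0 A x \<in> COP}"

definition consistent :: "real^'p^'p \<Rightarrow> ('n::finite \<Rightarrow> real^'p::finite^'p) \<Rightarrow> bool" where
  "consistent A0 A \<longleftrightarrow> feasible A0 A \<noteq> {}"

definition T_im ::
  "real^'p^'p \<Rightarrow> ('n::finite \<Rightarrow> real^'p::finite^'p) \<Rightarrow> (real^'p) set" where
  "T_im A0 A = {t \<in> simplex_T. \<forall>x \<in> feasible A0 A. t \<bullet> (calA A0 A x *v t) = 0}"

(* M(j) is M_set A0 A (\<tau> j). *)
definition M_set ::
  "real^'p^'p \<Rightarrow> ('n::finite \<Rightarrow> real^'p::finite^'p) \<Rightarrow> real^'p \<Rightarrow> 'p set" where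
  "M_set A0 A t = {k. \<forall>x \<in> feasible A0 A. axis k 1 \<bullet> (calA A0 A x *v t) = 0}"

definition P_star :: "('j \<Rightarrow> real^'p::finite) \<Rightarrow> 'j set \<Rightarrow> 'p set" where
  "P_star \<tau> I = (\<Union>j\<in>I. {k. \<tau> j $ k > 0})"

(* The list is a numbering i_1, ..., i_k of an index set; positions start at 0. *)
definition V_pairs :: "'j list \<Rightarrow> ('j \<times> 'j) set" where
  "V_pairs js = {(js ! k, js ! q) | k q. k \<le> q \<and> q < length js}"

definition max_slack ::
  "real^'p^'p \<Rightarrow> ('n::finite \<Rightarrow> real^'p::finite^'p) \<Rightarrow> real^'p^'p \<Rightarrow> bool" where
  "max_slack A0 A Y \<longleftrightarrow> Y \<in> rel_interior (calA A0 A ` feasible A0 A)"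

definition dir_cone :: "real^'p::finite^'p \<Rightarrow> (real^'p^'p) set \<Rightarrow> (real^'p^'p) set" where
  "dir_cone Y K = {D \<in> sym_mats. \<exists>\<epsilon>>0. Y + \<epsilon> *\<^sub>R D \<in> K}"

definition ldir_space :: "real^'p::finite^'p \<Rightarrow> (real^'p^'p) set \<Rightarrow> (real^'p^'p) set" where
  "ldir_space Y K = dir_cone Y K \<inter> uminus ` dir_cone Y K"

definition tan_space :: "real^'p::finite^'p \<Rightarrow> (real^'p^'p) set \<Rightarrow> (real^'p^'p) set" where
  "tan_space Y K = closure (dir_cone Y K) \<inter> uminus ` closure (dir_cone Y K)"

end

theory Submission
  imports Defs
begin

text \<open>
  Both conditions speak about the same matrices. Write \<open>Y\<close> for the maximum slack and call
  \<open>t\<close> in the simplex a zero of \<open>Y\<close> if \<open>t \<bullet> (Y *v t) = 0\<close>. For a symmetric matrix \<open>D\<close>,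

  \<^item> \<open>D\<close> lies in the tangent space at \<open>Y\<close> iff its quadratic form vanishes at all zeros of \<open>Y\<close>
    (\<open>tan_space_COP_iff\<close>);
  \<^item> \<open>D\<close> lies in the lineality space \<open>ldir\<close> iff \<open>(D *v t) $ k = 0\<close> for every zero \<open>t\<close> of \<open>Y\<close>
    and every \<open>k\<close> with \<open>(Y *v t) $ k = 0\<close> (\<open>ldir_space_COP_iff\<close>).

  Since \<open>Y\<close> is a relative interior point of the set of slacks, a linear functional that is
  non-negative on all slacks and vanishes at \<open>Y\<close> vanishes at all slacks. Hence the zeros of \<open>Y\<close> are
  exactly the immobile indices (\<open>T_im_eq_zero_set\<close>), and \<open>M(j)\<close> is the set of all \<open>k\<close> with
  \<open>(Y *v \<tau> j) $ k = 0\<close> (\<open>M_set_eq_gradient_zeros\<close>). Both criteria then reduce from all immobile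
  indices to the vertices \<open>\<tau> j\<close>: a quadratic form vanishes on a polytope iff the bilinear form
  vanishes on all pairs of its vertices, which gives the premise of B1; and because \<open>Y *v t\<close> is
  non-negative at zeros, a vanishing component of \<open>Y *v t\<close> vanishes at all vertices that
  contribute to \<open>t\<close>, which gives the conclusion of B1. So B1 says that \<open>calB A0 A z\<close> in the tangent
  space implies \<open>calB A0 A z\<close> in \<open>ldir\<close>, and this is B2.

  The one hard part is that the gradient condition makes \<open>D\<close> a feasible direction
  (\<open>dir_cone_COP_if_gradient_zero\<close>). There, minimizers \<open>u\<close> of \<open>Y + \<epsilon> D\<close> over the simplex for
  \<open>\<epsilon>\<close> tending to 0 are played off against their limit \<open>v\<close>: evaluating the bilinear form
  of one of these matrices at \<open>(u, v)\<close> in two ways gives both zero and the negative minimum.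
\<close>

section \<open>Symmetric matrices and their quadratic forms\<close>

lemma sym_mats_combination:
  assumes "D \<in> sym_mats" "E \<in> sym_mats"
  shows "a *\<^sub>R D + b *\<^sub>R E \<in> sym_mats"
  using assms by (simp add: sym_mats_def transpose_def vec_eq_iff)

lemma sym_mats_uminus: "D \<in> sym_mats \<Longrightarrow> - D \<in> sym_mats"
  by (simp add: sym_mats_def transpose_def vec_eq_iff)

lemma calB_sym_mats:
  assumes "A0 \<in> sym_mats" "\<And>m. A m \<in> sym_mats"
  shows "calB A0 A z \<in> sym_mats"
proof -
  have "A0 $ i $ j = A0 $ j $ i" "A m $ i $ j = A m $ j $ i" for m i j
    using assms(1) assms(2)[of m] by (auto simp: sym_mats_def transpose_def vec_eq_iff)
  then show ?thesis
    by (simp add: calB_def sym_mats_def transpose_def vec_eq_iff)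
qed

lemma sym_mats_form_commute:
  fixes D :: "real^'p::finite^'p"
  assumes "D \<in> sym_mats"
  shows "s \<bullet> (D *v t) = t \<bullet> (D *v s)"
  using assms
  by (metis (mono_tags, lifting) dot_lmul_matrix inner_commute mem_Collect_eq sym_mats_def
      transpose_matrix_vector)

lemma matrix_vector_combination:
  fixes Y D :: "real^'p::finite^'p"
  shows "(a *\<^sub>R Y + b *\<^sub>R D) *v t = a *\<^sub>R (Y *v t) + b *\<^sub>R (D *v t)"
  by (simp add: matrix_vector_mult_add_rdistrib scaleR_matrix_vector_assoc)

lemma form_combination:
  fixes Y D :: "real^'p::finite^'p"
  shows "s \<bullet> ((Y + e *\<^sub>R D) *v t) = s \<bullet> (Y *v t) + e * (s \<bullet> (D *v t))"
  using matrix_vector_combination[of 1 Y e D t] by (simp add: inner_right_distrib)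

lemma form_uminus:
  fixes D :: "real^'p::finite^'p"
  shows "s \<bullet> ((- D) *v t) = - (s \<bullet> (D *v t))"
  using form_combination[of s 0 "-1" D t] by simp

lemma form_sum:
  fixes D :: "real^'p::finite^'p"
  assumes "D \<in> sym_mats"
  shows "(s + c *\<^sub>R t) \<bullet> (D *v (s + c *\<^sub>R t))
    = s \<bullet> (D *v s) + 2 * c * (t \<bullet> (D *v s)) + c\<^sup>2 * (t \<bullet> (D *v t))"
  using sym_mats_form_commute[OF assms, of s t]
  by (simp add: matrix_vector_right_distrib matrix_vector_mult_scaleR inner_add_left
      inner_add_right power2_eq_square algebra_simps)

lemma continuous_form:
  fixes D :: "real^'p::finite^'p"
  shows "continuous_on X (\<lambda>t. t \<bullet> (D *v t))"
  by (intro continuous_intros linear_continuous_on matrix_vector_mul_bounded_linear)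

lemma bounded_linear_form:
  fixes s t :: "real^'p::finite"
  shows "bounded_linear (\<lambda>D. s \<bullet> (D *v t))"
proof -
  have "linear (\<lambda>D. s \<bullet> (D *v t))"
    by (rule linearI) (use form_combination[where e=1] form_combination[where Y=0] in auto)
  then show ?thesis by (simp add: linear_conv_bounded_linear)
qed

section \<open>Copositive matrices and the simplex\<close>

lemma compact_simplex_T: "compact (simplex_T :: (real^'p::finite) set)"
proof -
  have "closed {t::real^'p. (\<forall>k. 0 \<le> t $ k) \<and> (\<Sum>k\<in>UNIV. t $ k) = 1}"
    by (intro closed_Collect_conj closed_Collect_all closed_Collect_le closed_Collect_eq
        continuous_intros)
  moreover have "norm t \<le> 1" if "t \<in> simplex_T" for t :: "real^'p"
    using norm_le_l1_cart[of t] that by (simp add: simplex_T_def)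
  ultimately show ?thesis
    by (auto simp: compact_eq_bounded_closed bounded_iff simp flip: simplex_T_def)
qed

lemma simplex_T_nonempty: "(simplex_T :: (real^'p::finite) set) \<noteq> {}"
proof -
  have "axis k 1 \<in> simplex_T" for k :: 'p
    by (auto simp: simplex_T_def axis_def)
  then show ?thesis by blast
qed

lemma COP_iff_simplex:
  fixes D :: "real^'p::finite^'p"
  assumes "D \<in> sym_mats" and nn: "\<And>t. t \<in> simplex_T \<Longrightarrow> 0 \<le> t \<bullet> (D *v t)"
  shows "D \<in> COP"
proof -
  have "0 \<le> t \<bullet> (D *v t)" if t: "\<forall>k. 0 \<le> t $ k" for t :: "real^'p"
  proof (cases "t = 0")
    case False
    define r where "r = (\<Sum>k\<in>UNIV. t $ k)"
    have "0 \<le> r" using t by (simp add: r_def sum_nonneg)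
    moreover have "r \<noteq> 0"
      using t False by (auto simp: r_def sum_nonneg_eq_0_iff vec_eq_iff)
    ultimately have r: "0 < r" by simp
    have "(1 / r) *\<^sub>R t \<in> simplex_T"
      using t r by (auto simp: simplex_T_def r_def simp flip: sum_divide_distrib)
    from nn[OF this] have "0 \<le> (1 / r)\<^sup>2 * (t \<bullet> (D *v t))"
      by (simp add: matrix_vector_mult_scaleR power2_eq_square)
    then show ?thesis using r by (simp add: zero_le_mult_iff zero_le_divide_iff)
  qed simp
  with assms(1) show ?thesis by (simp add: COP_def)
qed

lemma COP_form_nonneg: "D \<in> COP \<Longrightarrow> t \<in> simplex_T \<Longrightarrow> 0 \<le> t \<bullet> (D *v t)"
  by (simp add: COP_def simplex_T_def)

lemma COP_sym_mats: "D \<in> COP \<Longrightarrow> D \<in> sym_mats"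
  by (simp add: COP_def)

text \<open>
  A zero of a copositive form is a minimum of the form over the non-negative orthant, so the
  derivative there in each coordinate direction, twice \<open>(D *v t) $ k\<close>, is non-negative.
\<close>

lemma COP_zero_gradient_nonneg:
  fixes D :: "real^'p::finite^'p"
  assumes D: "D \<in> COP" and t: "t \<in> simplex_T" and z: "t \<bullet> (D *v t) = 0"
  shows "0 \<le> (D *v t) $ k"
proof (rule ccontr)
  assume neg: "\<not> 0 \<le> (D *v t) $ k"
  define g where "g = - (D *v t) $ k"
  define h where "h = axis k 1 \<bullet> (D *v axis k 1)"
  \<comment> \<open>A step along the k-th axis so short that the linear term outweighs the quadratic one.\<close>
  define c where "c = g / (\<bar>h\<bar> + 1)"
  have g: "0 < g" using neg by (simp add: g_def)
  have c: "0 < c" using g by (simp add: c_def)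
  have "\<forall>l. 0 \<le> (t + c *\<^sub>R axis k 1) $ l"
    using t c by (auto simp: simplex_T_def axis_def)
  then have "0 \<le> (t + c *\<^sub>R axis k 1) \<bullet> (D *v (t + c *\<^sub>R axis k 1))"
    using D by (auto simp: COP_def)
  also have "\<dots> = c * (c * h - 2 * g)"
    using form_sum[OF COP_sym_mats[OF D], of t c "axis k 1"] z
    by (simp add: g_def h_def inner_axis' power2_eq_square algebra_simps)
  finally have "2 * g \<le> c * h" using c by (simp add: zero_le_mult_iff)
  also have "\<dots> \<le> c * (\<bar>h\<bar> + 1)" using c by (intro mult_left_mono) auto
  also have "\<dots> = g" by (simp add: c_def)
  finally show False using g by simp
qed

text \<open>
  The quadratic form of this matrix is \<open>(\<Sum>k. t $ k)\<^sup>2\<close>, the constant 1 on the simplex; adding a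
  multiple of it shifts a quadratic form by a constant there.
\<close>

definition ones :: "real^'p^'p" where "ones = (\<chi> i j. 1)"

lemma ones_sym_mats: "ones \<in> sym_mats"
  by (simp add: ones_def sym_mats_def transpose_def)

lemma ones_mult_simplex: "t \<in> simplex_T \<Longrightarrow> (ones *v t) $ k = 1"
  by (simp add: ones_def simplex_T_def matrix_vector_mult_def)

lemma ones_form_simplex: "t \<in> simplex_T \<Longrightarrow> t \<bullet> (ones *v t) = 1"
  by (simp add: inner_vec_def ones_mult_simplex) (simp add: simplex_T_def)

text \<open>
  This is the Lagrange condition for minimizing a quadratic form over the simplex. Shifting the form
  by its minimum value gives a copositive matrix with zero \<open>u\<close>. Its gradient at \<open>u\<close> is
  non-negative and orthogonal to the non-negative \<open>u\<close>, so it vanishes on the support of \<open>u\<close>.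
\<close>

lemma simplex_minimizer_gradient:
  fixes D :: "real^'p::finite^'p"
  assumes D: "D \<in> sym_mats" and u: "u \<in> simplex_T"
    and min: "\<And>t. t \<in> simplex_T \<Longrightarrow> u \<bullet> (D *v u) \<le> t \<bullet> (D *v t)"
    and k: "0 < u $ k"
  shows "(D *v u) $ k = u \<bullet> (D *v u)"
proof -
  define m where "m = u \<bullet> (D *v u)"
  define E where "E = D + (- m) *\<^sub>R ones"
  have Eform: "t \<bullet> (E *v t) = t \<bullet> (D *v t) - m" if "t \<in> simplex_T" for t
    using ones_form_simplex[OF that] unfolding E_def form_combination by simp
  have "E \<in> sym_mats"
    unfolding E_def using sym_mats_combination[OF D ones_sym_mats, of 1 "- m"] by simp
  then have "E \<in> COP"
    by (rule COP_iff_simplex) (use min Eform in \<open>auto simp: m_def\<close>)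
  moreover have E0: "u \<bullet> (E *v u) = 0" using Eform[OF u] by (simp add: m_def)
  ultimately have nn: "0 \<le> (E *v u) $ l" for l
    by (rule COP_zero_gradient_nonneg[OF _ u])
  have "(\<Sum>l\<in>UNIV. u $ l * (E *v u) $ l) = 0"
    using E0 by (simp add: inner_vec_def)
  then have "u $ k * (E *v u) $ k = 0"
    using u nn by (subst (asm) sum_nonneg_eq_0_iff) (auto simp: simplex_T_def)
  with k have "(E *v u) $ k = 0" by simp
  moreover have "(E *v u) $ k = (D *v u) $ k - m"
    using matrix_vector_combination[of 1 D "- m" ones u] ones_mult_simplex[OF u]
    by (simp add: E_def)
  ultimately show ?thesis by (simp add: m_def)
qed

section \<open>The tangent space of the copositive cone\<close>

definition zero_set :: "real^'p::finite^'p \<Rightarrow> (real^'p) set" where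
  "zero_set Y = {t \<in> simplex_T. t \<bullet> (Y *v t) = 0}"

lemma dir_cone_zero_set_nonneg:
  assumes "D \<in> dir_cone Y COP" "t \<in> zero_set Y"
  shows "0 \<le> t \<bullet> (D *v t)"
proof -
  obtain e where e: "0 < e" "Y + e *\<^sub>R D \<in> COP"
    using assms(1) by (auto simp: dir_cone_def)
  then have "0 \<le> t \<bullet> ((Y + e *\<^sub>R D) *v t)"
    using assms(2) by (intro COP_form_nonneg) (auto simp: zero_set_def)
  then show ?thesis
    using e assms(2) by (simp add: form_combination zero_set_def zero_le_mult_iff)
qed

text \<open>
  By compactness: where the form of \<open>D\<close> is not positive, the form of \<open>Y\<close> has no zeros and
  is bounded away from 0, so there a small multiple of \<open>D\<close> does no harm; elsewhere it only helps.
\<close>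

lemma dir_cone_COP_if_pos_on_zero_set:
  fixes Y D :: "real^'p::finite^'p"
  assumes Y: "Y \<in> COP" and D: "D \<in> sym_mats"
    and pos: "\<And>t. t \<in> zero_set Y \<Longrightarrow> 0 < t \<bullet> (D *v t)"
  shows "D \<in> dir_cone Y COP"
proof -
  define C where "C = {t \<in> simplex_T. t \<bullet> (D *v t) \<le> 0}"
  have "C = simplex_T \<inter> {t. t \<bullet> (D *v t) \<le> 0}" by (auto simp: C_def)
  then have C: "compact C"
    by (auto intro!: compact_Int_closed compact_simplex_T closed_Collect_le continuous_form)
  obtain c where c: "0 < c" "\<And>t. t \<in> C \<Longrightarrow> c \<le> t \<bullet> (Y *v t)"
  proof (cases "C = {}")
    case True
    then show ?thesis using that[of 1] by simp
  next
    case False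
    obtain s where s: "s \<in> C" "\<And>t. t \<in> C \<Longrightarrow> s \<bullet> (Y *v s) \<le> t \<bullet> (Y *v t)"
      using continuous_attains_inf[OF C False continuous_form[of C Y]] by blast
    have "0 \<le> s \<bullet> (Y *v s)" using s(1) Y by (simp add: C_def COP_form_nonneg)
    moreover have "s \<bullet> (Y *v s) \<noteq> 0"
      using s(1) pos[of s] by (auto simp: C_def zero_set_def)
    ultimately show ?thesis using that[of "s \<bullet> (Y *v s)"] s(2) by simp
  qed
  obtain b where b: "0 < b" "\<And>t. t \<in> simplex_T \<Longrightarrow> - b \<le> t \<bullet> (D *v t)"
  proof -
    obtain s :: "real^'p" where "\<And>t. t \<in> simplex_T \<Longrightarrow> s \<bullet> (D *v s) \<le> t \<bullet> (D *v t)"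
      using continuous_attains_inf[OF compact_simplex_T simplex_T_nonempty
          continuous_form[of simplex_T D]] by blast
    then show ?thesis using that[of "\<bar>s \<bullet> (D *v s)\<bar> + 1"] by fastforce
  qed
  have "Y + (c / b) *\<^sub>R D \<in> COP"
  proof (rule COP_iff_simplex)
    show "Y + (c / b) *\<^sub>R D \<in> sym_mats"
      using sym_mats_combination[OF COP_sym_mats[OF Y] D, of 1] by simp
    fix t :: "real^'p" assume t: "t \<in> simplex_T"
    have "0 \<le> t \<bullet> (Y *v t) + (c / b) * (t \<bullet> (D *v t))"
    proof (cases "t \<in> C")
      case True
      have "(c / b) * (- b) \<le> (c / b) * (t \<bullet> (D *v t))"
        using b c t by (intro mult_left_mono) auto
      then show ?thesis using c(2)[OF True] b(1) by simp
    next
      case False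
      then have "0 \<le> (c / b) * (t \<bullet> (D *v t))" using t b c by (simp add: C_def)
      then show ?thesis using COP_form_nonneg[OF Y t] by simp
    qed
    then show "0 \<le> t \<bullet> ((Y + (c / b) *\<^sub>R D) *v t)" by (simp add: form_combination)
  qed
  then show ?thesis
    using D b c by (auto simp: dir_cone_def intro!: exI[of _ "c / b"])
qed

text \<open>
  A form that is only non-negative on the zeros of \<open>Y\<close> becomes positive there after adding a small
  positive constant, that is, a small multiple of \<open>ones\<close>.
\<close>

lemma closure_dir_cone_COP:
  fixes Y D :: "real^'p::finite^'p"
  assumes Y: "Y \<in> COP" and D: "D \<in> sym_mats"
  shows "D \<in> closure (dir_cone Y COP) \<longleftrightarrow> (\<forall>t\<in>zero_set Y. 0 \<le> t \<bullet> (D *v t))"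
proof
  assume "D \<in> closure (dir_cone Y COP)"
  moreover have "closure (dir_cone Y COP) \<subseteq> {D. 0 \<le> t \<bullet> (D *v t)}" if "t \<in> zero_set Y" for t
    using that
    by (intro closure_minimal subsetI closed_Collect_le continuous_intros
        linear_continuous_on bounded_linear_form)
      (simp add: dir_cone_zero_set_nonneg)
  ultimately show "\<forall>t\<in>zero_set Y. 0 \<le> t \<bullet> (D *v t)" by blast
next
  assume nn: "\<forall>t\<in>zero_set Y. 0 \<le> t \<bullet> (D *v t)"
  have dir: "D + (1 / real (Suc n)) *\<^sub>R ones \<in> dir_cone Y COP" for n
  proof (rule dir_cone_COP_if_pos_on_zero_set[OF Y])
    show "D + (1 / real (Suc n)) *\<^sub>R ones \<in> sym_mats"
      using sym_mats_combination[OF D ones_sym_mats, of 1] by simp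
    show "0 < t \<bullet> ((D + (1 / real (Suc n)) *\<^sub>R ones) *v t)" if "t \<in> zero_set Y" for t
      using that nn unfolding form_combination
      by (simp add: zero_set_def ones_form_simplex add_nonneg_pos)
  qed
  have "(\<lambda>n. D + (1 / real (Suc n)) *\<^sub>R ones) \<longlonglongrightarrow> D + 0 *\<^sub>R ones"
    by (intro tendsto_intros LIMSEQ_Suc lim_1_over_n)
  then have "(\<lambda>n. D + (1 / real (Suc n)) *\<^sub>R ones) \<longlonglongrightarrow> D"
    by (simp only: scaleR_zero_left add_0_right)
  with dir show "D \<in> closure (dir_cone Y COP)"
    unfolding closure_sequential
    by (intro exI[of _ "\<lambda>n. D + (1 / real (Suc n)) *\<^sub>R ones"] conjI allI)
qed

lemma tan_space_COP_iff:
  fixes Y D :: "real^'p::finite^'p"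
  assumes Y: "Y \<in> COP" and D: "D \<in> sym_mats"
  shows "D \<in> tan_space Y COP \<longleftrightarrow> (\<forall>t\<in>zero_set Y. t \<bullet> (D *v t) = 0)"
proof -
  have "D \<in> tan_space Y COP \<longleftrightarrow>
      D \<in> closure (dir_cone Y COP) \<and> - D \<in> closure (dir_cone Y COP)"
    unfolding tan_space_def by (force simp: image_iff)
  then show ?thesis
    unfolding closure_dir_cone_COP[OF Y D] closure_dir_cone_COP[OF Y sym_mats_uminus[OF D]]
    by (auto simp: form_uminus order_antisym_conv)
qed

section \<open>The lineality space of the feasible directions\<close>

text \<open>
  For small \<open>\<epsilon> > 0\<close> both \<open>Y + \<epsilon> D\<close> and \<open>Y - \<epsilon> D\<close> are copositive, and \<open>t\<close> is a zero of both.
  Their gradients at \<open>t\<close> are non-negative, and in component \<open>k\<close> only the contribution of \<open>D\<close>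
  or \<open>- D\<close> is left.
\<close>

lemma ldir_space_COP_gradient_zero:
  fixes Y D :: "real^'p::finite^'p"
  assumes D: "D \<in> ldir_space Y COP" and t: "t \<in> zero_set Y" and k: "(Y *v t) $ k = 0"
  shows "(D *v t) $ k = 0"
proof -
  have half: "0 \<le> (E *v t) $ k"
    if E: "E \<in> dir_cone Y COP" and E0: "t \<bullet> (E *v t) = 0" for E
  proof -
    obtain e where e: "0 < e" "Y + e *\<^sub>R E \<in> COP" using E by (auto simp: dir_cone_def)
    have "t \<bullet> ((Y + e *\<^sub>R E) *v t) = 0"
      using t E0 by (simp add: form_combination zero_set_def)
    then have "0 \<le> ((Y + e *\<^sub>R E) *v t) $ k"
      using e t by (intro COP_zero_gradient_nonneg) (auto simp: zero_set_def)
    then show ?thesis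
      using e k matrix_vector_combination[of 1 Y e E t] by (simp add: zero_le_mult_iff)
  qed
  have dirs: "D \<in> dir_cone Y COP" "- D \<in> dir_cone Y COP"
    using D by (auto simp: ldir_space_def)
  have "t \<bullet> (D *v t) = 0"
    using dirs[THEN dir_cone_zero_set_nonneg, OF t] by (simp add: form_uminus)
  then have "0 \<le> (D *v t) $ k" "0 \<le> ((- D) *v t) $ k"
    using half[OF dirs(1)] half[OF dirs(2)] by (simp_all add: form_uminus)
  then show ?thesis
    using matrix_vector_combination[of 0 0 "-1" D t] by simp
qed

text \<open>
  Suppose that no \<open>E = Y + \<epsilon> D\<close> with \<open>\<epsilon> > 0\<close> is copositive. As \<open>\<epsilon>\<close> tends to 0, minimizers of
  these forms over the simplex accumulate, along a sequence with constant support \<open>Q\<close>, at some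
  zero \<open>v\<close> of \<open>Y\<close> supported in \<open>Q\<close>. For a minimizer \<open>u\<close> in this sequence, with its negative minimum
  \<open>m\<close>, all components of \<open>E *v u\<close> in \<open>Q\<close> equal \<open>m\<close>. As \<open>m\<close> tends to 0, the components of \<open>Y *v v\<close> in
  \<open>Q\<close> are 0, hence by hypothesis those of \<open>D *v v\<close> are 0 too. So \<open>E *v v\<close> vanishes on \<open>Q\<close> and
  \<open>u \<bullet> (E *v v) = 0\<close>, whereas \<open>v \<bullet> (E *v u) = m\<close>; as \<open>E\<close> is symmetric, this contradicts \<open>m < 0\<close>.
\<close>

lemma dir_cone_COP_if_gradient_zero:
  fixes Y D :: "real^'p::finite^'p"
  assumes Y: "Y \<in> COP" and D: "D \<in> sym_mats"
    and grad: "\<And>t k. t \<in> zero_set Y \<Longrightarrow> (Y *v t) $ k = 0 \<Longrightarrow> (D *v t) $ k = 0"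
  shows "D \<in> dir_cone Y COP"
proof (rule ccontr)
  assume nodir: "D \<notin> dir_cone Y COP"
  define E where "E = (\<lambda>n. Y + (1 / real (Suc n)) *\<^sub>R D)"
  have E_sym: "E n \<in> sym_mats" for n
    using sym_mats_combination[OF COP_sym_mats[OF Y] D, of 1] by (simp add: E_def)
  have E_mult: "E n *v t = Y *v t + (1 / real (Suc n)) *\<^sub>R (D *v t)" for n t
    using matrix_vector_combination[of 1 Y _ D t] by (simp add: E_def)
  have E_notCOP: "E n \<notin> COP" for n
    using nodir D by (auto simp: dir_cone_def E_def simp del: of_nat_Suc)
  have "\<exists>u\<in>simplex_T. \<forall>t\<in>simplex_T. u \<bullet> (E n *v u) \<le> t \<bullet> (E n *v t)" for n
    by (rule continuous_attains_inf[OF compact_simplex_T simplex_T_nonempty continuous_form])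
  then obtain u where u: "\<And>n. u n \<in> simplex_T"
    and min: "\<And>n t. t \<in> simplex_T \<Longrightarrow> u n \<bullet> (E n *v u n) \<le> t \<bullet> (E n *v t)"
    by metis
  define m where "m = (\<lambda>n. u n \<bullet> (E n *v u n))"
  have m_neg: "m n < 0" for n
    using COP_iff_simplex[OF E_sym, of n] E_notCOP[of n] min[of _ n]
    unfolding m_def by (meson dual_order.trans not_le)
  have crit: "(E n *v u n) $ k = m n" if "0 < u n $ k" for n k
    unfolding m_def by (rule simplex_minimizer_gradient[OF E_sym u min that])
  define supp where "supp = (\<lambda>n. {k. 0 < u n $ k})"
  \<comment> \<open>There are finitely many supports, so infinitely many of the minimizers share one.\<close>
  obtain n0 where n0: "infinite {n \<in> UNIV. supp n = supp n0}"
    using pigeonhole_infinite[of "UNIV :: nat set" supp] by auto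
  obtain f :: "nat \<Rightarrow> nat" where f: "strict_mono f" "\<And>i. supp (f i) = supp n0"
    using infinite_enumerate[OF n0] by blast
  define Q where "Q = supp n0"
  obtain v g where v: "v \<in> simplex_T" and g: "strict_mono g"
    and lim: "((\<lambda>i. u (f i)) \<circ> g) \<longlonglongrightarrow> v"
    using compact_simplex_T u unfolding compact_def by metis
  define h where "h = f \<circ> g"
  have h: "strict_mono h" unfolding h_def by (intro strict_mono_o f g)
  have lim_u: "(\<lambda>i. u (h i)) \<longlonglongrightarrow> v" using lim by (simp add: h_def o_def)
  have supp_h: "0 < u (h i) $ k \<longleftrightarrow> k \<in> Q" for i k
    using f(2)[of "g i"] by (auto simp: Q_def supp_def h_def)
  have u_off: "u (h i) $ k = 0" if "k \<notin> Q" for i k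
  proof -
    have "0 \<le> u (h i) $ k" using u[of "h i"] by (simp add: simplex_T_def)
    with that show ?thesis using supp_h[of i k] by simp
  qed
  have "(\<lambda>i. 1 / real (Suc (h i))) \<longlonglongrightarrow> 0"
    using LIMSEQ_subseq_LIMSEQ[OF LIMSEQ_Suc[OF lim_1_over_n] h] by (simp add: o_def)
  then have "(\<lambda>i. Y *v u (h i) + (1 / real (Suc (h i))) *\<^sub>R (D *v u (h i)))
      \<longlonglongrightarrow> Y *v v + 0 *\<^sub>R (D *v v)"
    by (intro tendsto_intros lim_u
        bounded_linear.tendsto[OF matrix_vector_mul_bounded_linear])
  then have lim_Eu: "(\<lambda>i. E (h i) *v u (h i)) \<longlonglongrightarrow> Y *v v"
    by (simp add: E_mult)
  have lim_m: "(\<lambda>i. m (h i)) \<longlonglongrightarrow> v \<bullet> (Y *v v)"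
    unfolding m_def by (intro tendsto_inner lim_u lim_Eu)
  have "v \<bullet> (Y *v v) \<le> 0"
    by (rule LIMSEQ_le_const2[OF lim_m]) (use m_neg less_imp_le in blast)
  then have v0: "v \<bullet> (Y *v v) = 0" using COP_form_nonneg[OF Y v] by simp
  then have vz: "v \<in> zero_set Y" using v by (simp add: zero_set_def)
  have v_off: "v $ k = 0" if "k \<notin> Q" for k
    using tendsto_vec_nth[OF lim_u, of k] u_off[OF that] by (simp add: LIMSEQ_const_iff)
  have Yv: "(Y *v v) $ k = 0" if "k \<in> Q" for k
  proof -
    have "(\<lambda>i. m (h i)) \<longlonglongrightarrow> (Y *v v) $ k"
      using tendsto_vec_nth[OF lim_Eu, of k] crit supp_h that by simp
    then show ?thesis using lim_m v0 LIMSEQ_unique by metis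
  qed
  \<comment> \<open>Any member of the subsequence serves as \<open>u\<close>; take the first one.\<close>
  define w where "w = u (h 0)"
  have "w \<bullet> (E (h 0) *v v) = 0"
    unfolding inner_vec_def
  proof (rule sum.neutral, rule ballI)
    fix k
    show "w $ k \<bullet> (E (h 0) *v v) $ k = 0"
      using u_off[of k 0] Yv[of k] grad[OF vz, of k] by (cases "k \<in> Q") (auto simp: w_def E_mult)
  qed
  moreover have "v \<bullet> (E (h 0) *v w) = m (h 0)"
  proof -
    have "v \<bullet> (E (h 0) *v w) = (\<Sum>k\<in>UNIV. v $ k * m (h 0))"
      unfolding inner_vec_def
    proof (rule sum.cong[OF refl])
      fix k
      show "v $ k \<bullet> (E (h 0) *v w) $ k = v $ k * m (h 0)"
        using v_off[of k] crit[of "h 0" k] supp_h[of 0 k] by (cases "k \<in> Q") (auto simp: w_def)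
    qed
    also have "\<dots> = m (h 0)"
      using v by (simp add: simplex_T_def flip: sum_distrib_right)
    finally show ?thesis .
  qed
  ultimately show False
    using m_neg[of "h 0"] sym_mats_form_commute[OF E_sym, of w "h 0" v] by simp
qed

lemma ldir_space_COP_iff:
  fixes Y D :: "real^'p::finite^'p"
  assumes Y: "Y \<in> COP" and D: "D \<in> sym_mats"
  shows "D \<in> ldir_space Y COP \<longleftrightarrow>
    (\<forall>t\<in>zero_set Y. \<forall>k. (Y *v t) $ k = 0 \<longrightarrow> (D *v t) $ k = 0)"
proof
  assume grad: "\<forall>t\<in>zero_set Y. \<forall>k. (Y *v t) $ k = 0 \<longrightarrow> (D *v t) $ k = 0"
  have "D \<in> dir_cone Y COP"
    using grad by (intro dir_cone_COP_if_gradient_zero[OF Y D]) blast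
  moreover have "((- D) *v t) $ k = - (D *v t) $ k" for t k
    using matrix_vector_combination[of 0 0 "-1" D t] by simp
  then have "- D \<in> dir_cone Y COP"
    using grad by (intro dir_cone_COP_if_gradient_zero[OF Y sym_mats_uminus[OF D]]) auto
  ultimately show "D \<in> ldir_space Y COP"
    unfolding ldir_space_def by (metis IntI image_eqI minus_minus)
qed (use ldir_space_COP_gradient_zero in blast)

section \<open>Maximum slacks and immobile indices\<close>

text \<open>
  The segment from \<open>x\<close> to the relative interior point \<open>y\<close> can be prolonged inside \<open>C\<close> beyond \<open>y\<close>; a
  positive value at \<open>x\<close> would make \<open>L\<close> negative there.
\<close>

lemma linear_zero_from_rel_interior:
  fixes L :: "'a::euclidean_space \<Rightarrow> real"
  assumes L: "linear L" and conv: "convex C" and nn: "\<And>x. x \<in> C \<Longrightarrow> 0 \<le> L x"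
    and y: "y \<in> rel_interior C" "L y = 0" and x: "x \<in> C"
  shows "L x = 0"
proof -
  have "x \<in> affine hull C" using x by (simp add: hull_inc)
  then obtain e where e: "1 < e" "(1 - e) *\<^sub>R x + e *\<^sub>R y \<in> C"
    using convex_rel_interior_if[OF conv y(1)] by blast
  then have "0 \<le> (1 - e) * L x"
    using nn[OF e(2)] y(2) by (simp add: linear_add[OF L] linear_scale[OF L])
  then show ?thesis using e(1) nn[OF x] by (simp add: zero_le_mult_iff)
qed

lemma convex_COP: "convex (COP :: (real^'p::finite^'p) set)"
proof (rule convexI)
  fix D E :: "real^'p^'p" and a b :: real
  assume DE: "D \<in> COP" "E \<in> COP" and ab: "0 \<le> a" "0 \<le> b"
  have "t \<bullet> ((a *\<^sub>R D + b *\<^sub>R E) *v t) = a * (t \<bullet> (D *v t)) + b * (t \<bullet> (E *v t))" for t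
    by (simp add: matrix_vector_combination inner_add_right)
  then show "a *\<^sub>R D + b *\<^sub>R E \<in> COP"
    using DE ab
    by (intro COP_iff_simplex sym_mats_combination) (simp_all add: COP_sym_mats COP_form_nonneg)
qed

lemma convex_slacks: "convex (calA A0 A ` feasible A0 A)"
proof -
  have lin: "calA A0 A (a *\<^sub>R x + b *\<^sub>R y) = a *\<^sub>R calA A0 A x + b *\<^sub>R calA A0 A y"
    if "a + b = 1" for a b x y
  proof -
    have "A0 = a *\<^sub>R A0 + b *\<^sub>R A0"
      using that by (simp flip: scaleR_left_distrib)
    then show ?thesis
      by (simp add: calA_def scaleR_right_distrib scaleR_left_distrib sum.distrib
          scaleR_sum_right)
  qed
  show ?thesis
  proof (rule convexI)
    fix Y Z :: "real^'a^'a" and a b :: real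
    assume Y: "Y \<in> calA A0 A ` feasible A0 A" and Z: "Z \<in> calA A0 A ` feasible A0 A"
      and ab: "0 \<le> a" "0 \<le> b" "a + b = 1"
    then obtain x y where xy: "Y = calA A0 A x" "Z = calA A0 A y"
      "calA A0 A x \<in> COP" "calA A0 A y \<in> COP" by (auto simp: feasible_def)
    have "a *\<^sub>R Y + b *\<^sub>R Z \<in> COP"
      using xy ab convexD[OF convex_COP] by metis
    then show "a *\<^sub>R Y + b *\<^sub>R Z \<in> calA A0 A ` feasible A0 A"
      using lin[OF ab(3), of x y] xy
      by (intro image_eqI[of _ _ "a *\<^sub>R x + b *\<^sub>R y"]) (simp_all add: feasible_def)
  qed
qed

lemma max_slack_COP: "max_slack A0 A Y \<Longrightarrow> Y \<in> COP"
  using rel_interior_subset by (fastforce simp: max_slack_def feasible_def)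

lemma max_slack_form_zero:
  assumes Y: "max_slack A0 A Y" "s \<bullet> (Y *v t) = 0"
    and nn: "\<And>x. x \<in> feasible A0 A \<Longrightarrow> 0 \<le> s \<bullet> (calA A0 A x *v t)"
    and x: "x \<in> feasible A0 A"
  shows "s \<bullet> (calA A0 A x *v t) = 0"
  by (rule linear_zero_from_rel_interior
      [OF bounded_linear.linear[OF bounded_linear_form] convex_slacks, where y=Y])
    (use assms in \<open>auto simp: max_slack_def\<close>)

lemma max_slack_attained: "max_slack A0 A Y \<Longrightarrow> \<exists>x\<in>feasible A0 A. Y = calA A0 A x"
  using rel_interior_subset by (fastforce simp: max_slack_def)

text \<open>
  For \<open>t\<close> in the simplex, the functional \<open>D \<mapsto> t \<bullet> (D *v t)\<close> is linear and non-negative on all slacks,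
  so it vanishes on all of them as soon as it vanishes at the maximum slack.
\<close>

lemma T_im_eq_zero_set:
  assumes Y: "max_slack A0 A Y"
  shows "T_im A0 A = zero_set Y"
proof -
  have "t \<bullet> (calA A0 A x *v t) = 0"
    if "t \<in> simplex_T" "t \<bullet> (Y *v t) = 0" "x \<in> feasible A0 A" for t x
    by (rule max_slack_form_zero[OF Y that(2) _ that(3)])
      (use that in \<open>auto simp: feasible_def COP_form_nonneg\<close>)
  then show ?thesis
    using max_slack_attained[OF Y] by (auto simp: T_im_def zero_set_def)
qed

text \<open>
  An immobile \<open>t\<close> is a zero of every slack \<open>D\<close>, so the gradient component \<open>(D *v t) $ k\<close>, which is
  linear in \<open>D\<close>, is non-negative on all slacks; again the maximum slack decides whether it vanishes.
\<close>

lemma M_set_eq_gradient_zeros: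
  assumes Y: "max_slack A0 A Y" and t: "t \<in> T_im A0 A"
  shows "M_set A0 A t = {k. (Y *v t) $ k = 0}"
proof -
  have "axis k 1 \<bullet> (calA A0 A x *v t) = 0"
    if "(Y *v t) $ k = 0" "x \<in> feasible A0 A" for k x
  proof (rule max_slack_form_zero[OF Y _ _ that(2)])
    show "axis k 1 \<bullet> (Y *v t) = 0" using that by (simp add: inner_axis')
    show "0 \<le> axis k 1 \<bullet> (calA A0 A x *v t)" if "x \<in> feasible A0 A" for x
      using that t COP_zero_gradient_nonneg[of "calA A0 A x" t k]
      by (simp add: inner_axis' feasible_def T_im_def)
  qed
  then show ?thesis
    using max_slack_attained[OF Y] by (auto simp: M_set_def inner_axis')
qed

section \<open>Reduction to the vertices\<close>

text \<open>
  From left to right by polarization at the midpoint of \<open>s\<close> and \<open>t\<close>; from right to left because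
  each kernel of the bilinear form in one argument is convex.
\<close>

lemma form_zero_on_convex_hull_iff:
  fixes D :: "real^'p::finite^'p"
  assumes D: "D \<in> sym_mats"
  shows "(\<forall>t\<in>convex hull X. t \<bullet> (D *v t) = 0) \<longleftrightarrow> (\<forall>s\<in>X. \<forall>t\<in>X. s \<bullet> (D *v t) = 0)"
proof
  assume hull: "\<forall>t\<in>convex hull X. t \<bullet> (D *v t) = 0"
  show "\<forall>s\<in>X. \<forall>t\<in>X. s \<bullet> (D *v t) = 0"
  proof (intro ballI)
    fix s t assume st: "s \<in> X" "t \<in> X"
    then have in_hull: "s \<in> convex hull X" "t \<in> convex hull X" by (auto intro: hull_inc)
    then have "(1/2) *\<^sub>R s + (1/2) *\<^sub>R t \<in> convex hull X"
      by (intro convexD convex_convex_hull) auto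
    then have "((1/2) *\<^sub>R (s + 1 *\<^sub>R t)) \<bullet> (D *v ((1/2) *\<^sub>R (s + 1 *\<^sub>R t))) = 0"
      using hull by (simp add: scaleR_add_right)
    then have "(s + 1 *\<^sub>R t) \<bullet> (D *v (s + 1 *\<^sub>R t)) = 0"
      by (simp add: matrix_vector_mult_scaleR)
    then have "t \<bullet> (D *v s) = 0"
      unfolding form_sum[OF D] using hull in_hull by simp
    then show "s \<bullet> (D *v t) = 0" using sym_mats_form_commute[OF D] by metis
  qed
next
  assume pairs: "\<forall>s\<in>X. \<forall>t\<in>X. s \<bullet> (D *v t) = 0"
  have kernel: "convex {t. s \<bullet> (D *v t) = 0}" for s
    by (rule convexI) (simp add: matrix_vector_right_distrib matrix_vector_mult_scaleR
        inner_add_right)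
  have half: "s \<bullet> (D *v t) = 0" if "s \<in> X" "t \<in> convex hull X" for s t
    using hull_minimal[where S=convex, OF _ kernel, of X s] pairs that by blast
  have "t \<bullet> (D *v s) = 0" if "s \<in> convex hull X" "t \<in> convex hull X" for s t
  proof -
    have "X \<subseteq> {s. t \<bullet> (D *v s) = 0}"
      using half[OF _ that(2)] by (simp add: subset_iff sym_mats_form_commute[OF D, of t])
    then show ?thesis using hull_minimal[where S=convex, OF _ kernel, of X t] that(1) by blast
  qed
  then show "\<forall>t\<in>convex hull X. t \<bullet> (D *v t) = 0" by blast
qed

text \<open>
  If a convex combination of non-negative numbers is 0, then all of them with positive weight are 0.
\<close>

lemma gradient_zero_on_convex_hull:
  fixes Y D :: "real^'p::finite^'p"
  assumes fin: "finite X" and nn: "\<And>v. v \<in> X \<Longrightarrow> 0 \<le> (Y *v v) $ k"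
    and imp: "\<And>v. v \<in> X \<Longrightarrow> (Y *v v) $ k = 0 \<Longrightarrow> (D *v v) $ k = 0"
    and t: "t \<in> convex hull X" "(Y *v t) $ k = 0"
  shows "(D *v t) $ k = 0"
proof -
  obtain c where c: "\<And>v. v \<in> X \<Longrightarrow> 0 \<le> c v" "(\<Sum>v\<in>X. c v *\<^sub>R v) = t"
    using t(1) unfolding convex_hull_finite[OF fin] by auto
  have comb: "(M *v t) $ k = (\<Sum>v\<in>X. c v * (M *v v) $ k)" for M :: "real^'p^'p"
    unfolding c(2)[symmetric]
    by (simp add: linear_sum[OF matrix_vector_mul_linear] matrix_vector_mult_scaleR)
  have "\<forall>v\<in>X. c v * (Y *v v) $ k = 0"
    using t(2) c(1) nn fin unfolding comb by (subst (asm) sum_nonneg_eq_0_iff) auto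
  then have "c v * (D *v v) $ k = 0" if "v \<in> X" for v using imp that by fastforce
  then show ?thesis unfolding comb by (rule sum.neutral[OF ballI])
qed

text \<open>
  The pairs of a numbering list each unordered pair of indices in only one order, which is enough for
  a symmetric relation.
\<close>

lemma V_pairs_symmetric_iff:
  assumes "\<And>i j. R i j \<longleftrightarrow> R j i"
  shows "(\<forall>(i, j)\<in>V_pairs js. R i j) \<longleftrightarrow> (\<forall>i\<in>set js. \<forall>j\<in>set js. R i j)"
proof
  assume V: "\<forall>(i, j)\<in>V_pairs js. R i j"
  show "\<forall>i\<in>set js. \<forall>j\<in>set js. R i j"
  proof (intro ballI)
    fix i j assume "i \<in> set js" "j \<in> set js"
    then obtain k q where kq: "k < length js" "js ! k = i" "q < length js" "js ! q = j"
      by (metis in_set_conv_nth)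
    then have "(i, j) \<in> V_pairs js \<or> (j, i) \<in> V_pairs js"
      unfolding V_pairs_def using nat_le_linear[of k q] by blast
    then show "R i j" using V assms by blast
  qed
qed (auto simp: V_pairs_def)

section \<open>Equivalence of the two conditions\<close>

theorem proposition8:
  fixes A0 :: "real^'p::finite^'p"
    and A :: "'n::finite \<Rightarrow> real^'p^'p"
    and Ystar :: "real^'p^'p"
    and J :: "'j set" and \<tau> :: "'j \<Rightarrow> real^'p"
    and S :: "'s set" and Js :: "'s \<Rightarrow> 'j set"
    and numbering :: "'s \<Rightarrow> 'j list"
    and V0 :: "('j \<times> 'j) set"
  assumes "CARD('p) > 1"
    and "A0 \<in> sym_mats" and "\<And>m. A m \<in> sym_mats"
    and "consistent A0 A"
    and "max_slack A0 A Ystar"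
    and "finite J"
    and "\<tau> ` J = {v. v extreme_point_of (convex hull T_im A0 A)}"
    and "finite S"
    and "\<And>s. s \<in> S \<Longrightarrow> Js s \<subseteq> J"
    and "T_im A0 A = (\<Union>s\<in>S. convex hull (\<tau> ` Js s))"
    and "\<And>s j. s \<in> S \<Longrightarrow> j \<in> Js s \<Longrightarrow> P_star \<tau> (Js s) \<subseteq> M_set A0 A (\<tau> j)"
    and "\<And>s. s \<in> S \<Longrightarrow> distinct (numbering s) \<and> set (numbering s) = Js s"
    and "V0 = (\<Union>s\<in>S. V_pairs (numbering s))"
  shows "(\<forall>z::real \<times> (real^'n).
            (\<forall>(i, j)\<in>V0. \<tau> i \<bullet> (calB A0 A z *v \<tau> j) = 0) \<longrightarrow>
            (\<forall>j\<in>J. \<forall>k\<in>M_set A0 A (\<tau> j). axis k 1 \<bullet> (calB A0 A z *v \<tau> j) = 0))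
         \<longleftrightarrow>
         range (calB A0 A) \<inter> (tan_space Ystar COP - ldir_space Ystar COP) = {}"
proof -
  let ?B = "calB A0 A"
  note Y = \<open>max_slack A0 A Ystar\<close>
  have COP: "Ystar \<in> COP" using Y by (rule max_slack_COP)
  have Bsym: "?B z \<in> sym_mats" for z using assms(2,3) by (rule calB_sym_mats)
  have T: "T_im A0 A = zero_set Ystar" using Y by (rule T_im_eq_zero_set)
  have \<tau>_T: "\<tau> j \<in> zero_set Ystar" if "j \<in> J" for j
    using assms(7) that extreme_point_of_convex_hull[of "\<tau> j" "T_im A0 A"] T by blast
  have tan: "?B z \<in> tan_space Ystar COP \<longleftrightarrow>
      (\<forall>(i, j)\<in>V0. \<tau> i \<bullet> (?B z *v \<tau> j) = 0)" for z
  proof -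
    have "?B z \<in> tan_space Ystar COP \<longleftrightarrow>
        (\<forall>s\<in>S. \<forall>t\<in>convex hull (\<tau> ` Js s). t \<bullet> (?B z *v t) = 0)"
      unfolding tan_space_COP_iff[OF COP Bsym] T[symmetric] assms(10) by blast
    also have "\<dots> \<longleftrightarrow> (\<forall>s\<in>S. \<forall>i\<in>Js s. \<forall>j\<in>Js s. \<tau> i \<bullet> (?B z *v \<tau> j) = 0)"
      unfolding form_zero_on_convex_hull_iff[OF Bsym] by blast
    also have "\<dots> \<longleftrightarrow> (\<forall>s\<in>S. \<forall>(i, j)\<in>V_pairs (numbering s). \<tau> i \<bullet> (?B z *v \<tau> j) = 0)"
    proof (rule ball_cong[OF refl])
      fix s assume s: "s \<in> S"
      have comm: "\<tau> i \<bullet> (?B z *v \<tau> j) = 0 \<longleftrightarrow> \<tau> j \<bullet> (?B z *v \<tau> i) = 0" for i j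
        using sym_mats_form_commute[OF Bsym] by metis
      show "(\<forall>i\<in>Js s. \<forall>j\<in>Js s. \<tau> i \<bullet> (?B z *v \<tau> j) = 0) \<longleftrightarrow>
          (\<forall>(i, j)\<in>V_pairs (numbering s). \<tau> i \<bullet> (?B z *v \<tau> j) = 0)"
        using V_pairs_symmetric_iff[of "\<lambda>i j. \<tau> i \<bullet> (?B z *v \<tau> j) = 0", OF comm]
          assms(12)[OF s] by simp
    qed
    also have "\<dots> \<longleftrightarrow> (\<forall>(i, j)\<in>V0. \<tau> i \<bullet> (?B z *v \<tau> j) = 0)"
      unfolding assms(13) by blast
    finally show ?thesis .
  qed
  have ldir: "?B z \<in> ldir_space Ystar COP \<longleftrightarrow>
      (\<forall>j\<in>J. \<forall>k\<in>M_set A0 A (\<tau> j). axis k 1 \<bullet> (?B z *v \<tau> j) = 0)" for z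
  proof -
    have "(\<forall>j\<in>J. \<forall>k\<in>M_set A0 A (\<tau> j). axis k 1 \<bullet> (?B z *v \<tau> j) = 0) \<longleftrightarrow>
        (\<forall>j\<in>J. \<forall>k. (Ystar *v \<tau> j) $ k = 0 \<longrightarrow> (?B z *v \<tau> j) $ k = 0)"
      using M_set_eq_gradient_zeros[OF Y] \<tau>_T T by (auto simp: inner_axis')
    also have "\<dots> \<longleftrightarrow> (\<forall>t\<in>zero_set Ystar. \<forall>k.
        (Ystar *v t) $ k = 0 \<longrightarrow> (?B z *v t) $ k = 0)"
    proof
      assume vert: "\<forall>j\<in>J. \<forall>k. (Ystar *v \<tau> j) $ k = 0 \<longrightarrow> (?B z *v \<tau> j) $ k = 0"
      show "\<forall>t\<in>zero_set Ystar. \<forall>k. (Ystar *v t) $ k = 0 \<longrightarrow> (?B z *v t) $ k = 0"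
      proof (intro ballI allI impI)
        fix t k assume t: "t \<in> zero_set Ystar" and k: "(Ystar *v t) $ k = 0"
        obtain s where s: "s \<in> S" "t \<in> convex hull (\<tau> ` Js s)"
          using t unfolding T[symmetric] assms(10) by blast
        show "(?B z *v t) $ k = 0"
        proof (rule gradient_zero_on_convex_hull[OF _ _ _ s(2) k])
          show "finite (\<tau> ` Js s)"
            using assms(6) assms(9)[OF s(1)] finite_subset by blast
          fix v assume "v \<in> \<tau> ` Js s"
          then obtain j where j: "v = \<tau> j" "j \<in> J" using assms(9)[OF s(1)] by blast
          show "0 \<le> (Ystar *v v) $ k"
            using COP_zero_gradient_nonneg[OF COP] \<tau>_T[OF j(2)] j(1)
            by (simp add: zero_set_def)
          show "(?B z *v v) $ k = 0" if "(Ystar *v v) $ k = 0"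
            using vert j that by blast
        qed
      qed
    qed (use \<tau>_T in blast)
    finally show ?thesis unfolding ldir_space_COP_iff[OF COP Bsym] by blast
  qed
  show ?thesis unfolding tan[symmetric] ldir[symmetric] by blast
qed

end
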